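(* Let $q=p^r$ with $p$ an odd prime, let $k>q+3$, and let $0\leqslant j\leqslant q-2$ be such that the class $C_j$ has exactly two elements. Then the matrix $M_j$ is diagonalizable over $\mathbb{C}_\infty$.
   Context: Let $A=\mathbb{F}_q[t]$, $\mathbb{C}_\infty$ the completion of an algebraic closure of $\mathbb{F}_q((1/t))$. Let $\Gamma_1(t)=\{\gamma\in GL_2(A):\gamma\equiv\left(\begin{smallmatrix}1&*\\0&1\end{smallmatrix}\right)\pmod t\}$ and $S^1_k(\Gamma_1(t))$ the $\mathbb{C}_\infty$-space of Drinfeld cusp forms of weight $k$ for $\Gamma_1(t)$ on the Drinfeld upper half plane, with Atkin operator $U_t(f)(z)=\sum_{\beta\in\mathbb{F}_q}f\big(\frac{z+\beta}{t}\big)$ (up to a nonzero normalizing scalar). Via Teitelbaum's isomorphism with harmonic cocycles, $S^1_k(\Gamma_1(t))$ has a basis $c_0,\dots,c_{k-2}$ on which $$U_t(c_j)=-(-t)^{j+1}\binom{k-2-j}{j}c_j-t^{j+1}\sum_{h\neq 0}\left[\binom{k-2-j-h(q-1)}{-h(q-1)}+(-1)^{j+1}\binom{k-2-j-h(q-1)}{j}\right]c_{j+h(q-1)},$$ with $c_i=0$ for $i\notin[0,k-2]$, binomial coefficients reduced into $\mathbb{F}_p\subset\mathbb{C}_\infty$ and $\binom{n}{m}=0$ if $m<0$ or $m>n$. For $0\leqslant j\leqslant q-2$, $C_j=\{c_\ell:0\leqslant\ell\leqslant k-2,\ \ell\equiv j\pmod{q-1}\}$; its span is $U_t$-stable and $M_j$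 is the matrix of $U_t$ on it in the basis $C_j$. *)

theory Defs
  imports
    "HOL-Algebra.Algebraic_Closure_Type"
    "HOL-Analysis.Abstract_Metric_Spaces"
    "Jordan_Normal_Form.Matrix"
    "HOL-Library.Function_Algebras"
    "HOL-Number_Theory.Cong"
    "HOL-Computational_Algebra.Formal_Laurent_Series"
begin

subsection \<open>The field of complex numbers at infinity\<close>

text \<open>
  The finite type \<open>'a\<close> is the field with \<open>q = CARD('a)\<close> elements. The Laurent series field
  \<open>'a fls\<close> is \<open>F_q((1/t))\<close>: the series variable \<open>fls_X\<close> stands for \<open>1/t\<close>, so \<open>t\<close> itself is
  \<open>fls_X_inv\<close> and \<open>\<bar>t\<bar> = q\<close>.

  The locale says that \<open>'c\<close>, with absolute value \<open>nrm\<close>, is the completion of the algebraic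
  closure of \<open>F_q((1/t))\<close>. An absolute value on the algebraic closure extending the one of
  \<open>F_q((1/t))\<close> is unique, hence so is the pair \<open>('c, nrm)\<close> up to isometric isomorphism.
\<close>

locale C_infinity =
  fixes emb :: "'a::{finite,field} fls alg_closure \<Rightarrow> 'c::field"
    and nrm :: "'c \<Rightarrow> real"
  assumes emb_1: "emb 1 = 1"
    and emb_add: "emb (x + y) = emb x + emb y"
    and emb_mult: "emb (x * y) = emb x * emb y"
    and nrm_nonneg: "0 \<le> nrm a"
    and nrm_eq_0: "nrm a = 0 \<longleftrightarrow> a = 0"
    and nrm_mult: "nrm (a * b) = nrm a * nrm b"
    and nrm_add: "nrm (a + b) \<le> max (nrm a) (nrm b)"
    and nrm_emb: "f \<noteq> 0 \<Longrightarrow> nrm (emb (to_ac f)) = real CARD('a) powi (- fls_subdegree f)"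
    and dense: "0 < \<epsilon> \<Longrightarrow> \<exists>x. nrm (a - emb x) < \<epsilon>"
    and complete: "Metric_space.mcomplete UNIV (\<lambda>a b. nrm (a - b))"

definition K_inf :: "('a::field fls alg_closure \<Rightarrow> 'c) \<Rightarrow> 'c set" where
  "K_inf emb = range (\<lambda>f. emb (to_ac f))"

definition const_F :: "('a::field fls alg_closure \<Rightarrow> 'c) \<Rightarrow> 'a \<Rightarrow> 'c" where
  "const_F emb b = emb (to_ac (fls_const b))"

definition t_C :: "('a::field fls alg_closure \<Rightarrow> 'c) \<Rightarrow> 'c" where
  "t_C emb = emb (to_ac fls_X_inv)"

text \<open>The inclusion of \<open>A = F_q[t]\<close>, modelled by \<open>'a poly\<close>, whose variable \<open>[:0, 1:]\<close> is \<open>t\<close>.\<close>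

definition poly_C :: "('a::field fls alg_closure \<Rightarrow> 'c::comm_ring_1) \<Rightarrow> 'a poly \<Rightarrow> 'c" where
  "poly_C emb a = (\<Sum>i\<le>degree a. const_F emb (coeff a i) * t_C emb ^ i)"

subsection \<open>The upper half plane and rigid analytic functions\<close>

definition Omega :: "('a::field fls alg_closure \<Rightarrow> 'c) \<Rightarrow> 'c set" where
  "Omega emb = - K_inf emb"

definition imag_abs :: "('a::field fls alg_closure \<Rightarrow> 'c::field) \<Rightarrow> ('c \<Rightarrow> real) \<Rightarrow> 'c \<Rightarrow> real" where
  "imag_abs emb nrm z = (INF x\<in>K_inf emb. nrm (z - x))"

text \<open>The standard admissible covering of \<open>Omega\<close> by an increasing sequence of affinoids.\<close>

definition Omega_n ::
  "('a::{finite,field} fls alg_closure \<Rightarrow> 'c::field) \<Rightarrow> ('c \<Rightarrow> real) \<Rightarrow> nat \<Rightarrow> 'c set" where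
  "Omega_n emb nrm n =
     {z. nrm z \<le> real CARD('a) ^ n \<and> imag_abs emb nrm z \<ge> inverse (real CARD('a) ^ n)}"

text \<open>A function is rigid analytic on \<open>Omega\<close> if on each member of the covering it is a uniform
  limit of rational functions without poles there.\<close>

definition rigid_analytic ::
  "('a::{finite,field} fls alg_closure \<Rightarrow> 'c::field) \<Rightarrow> ('c \<Rightarrow> real) \<Rightarrow> ('c \<Rightarrow> 'c) \<Rightarrow> bool" where
  "rigid_analytic emb nrm f \<longleftrightarrow>
     (\<forall>n. \<forall>\<epsilon>>0. \<exists>P Q. \<forall>z\<in>Omega_n emb nrm n.
        poly Q z \<noteq> 0 \<and> nrm (f z - poly P z / poly Q z) < \<epsilon>)"

subsection \<open>Drinfeld cusp forms\<close>

definition GL2_A :: "'a::field poly mat set" where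
  "GL2_A = {\<gamma> \<in> carrier_mat 2 2. invertible_mat \<gamma>}"

definition Gamma1_t :: "'a::field poly mat set" where
  "Gamma1_t = {\<gamma> \<in> GL2_A. [\<gamma> $$ (0,0) = 1] (mod [:0, 1:]) \<and>
     [\<gamma> $$ (1,0) = 0] (mod [:0, 1:]) \<and> [\<gamma> $$ (1,1) = 1] (mod [:0, 1:])}"

definition aut_factor ::
  "('a::field fls alg_closure \<Rightarrow> 'c::field) \<Rightarrow> 'a poly mat \<Rightarrow> 'c \<Rightarrow> 'c" where
  "aut_factor emb \<gamma> z = poly_C emb (\<gamma> $$ (1,0)) * z + poly_C emb (\<gamma> $$ (1,1))"

definition moebius ::
  "('a::field fls alg_closure \<Rightarrow> 'c::field) \<Rightarrow> 'a poly mat \<Rightarrow> 'c \<Rightarrow> 'c" where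
  "moebius emb \<gamma> z =
     (poly_C emb (\<gamma> $$ (0,0)) * z + poly_C emb (\<gamma> $$ (0,1))) / aut_factor emb \<gamma> z"

text \<open>The Carlitz-type exponential \<open>z \<Prod> (1 - z/\<lambda>)\<close>, over the nonzero \<open>\<lambda>\<close> in the lattice \<open>tA\<close>,
  and the parameter at infinity \<open>1/exp_tA z\<close> for the group of translations by \<open>tA\<close>.\<close>

definition exp_tA_part :: "('a::field fls alg_closure \<Rightarrow> 'c::field) \<Rightarrow> nat \<Rightarrow> 'c \<Rightarrow> 'c" where
  "exp_tA_part emb d z =
     z * (\<Prod>a\<in>{a. a \<noteq> 0 \<and> degree a < d}. 1 - z / (t_C emb * poly_C emb a))"

definition exp_tA :: "('a::field fls alg_closure \<Rightarrow> 'c::field) \<Rightarrow> ('c \<Rightarrow> real) \<Rightarrow> 'c \<Rightarrow> 'c" where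
  "exp_tA emb nrm z = (THE w. (\<lambda>d. nrm (exp_tA_part emb d z - w)) \<longlonglongrightarrow> 0)"

definition u_tA :: "('a::field fls alg_closure \<Rightarrow> 'c::field) \<Rightarrow> ('c \<Rightarrow> real) \<Rightarrow> 'c \<Rightarrow> 'c" where
  "u_tA emb nrm z = inverse (exp_tA emb nrm z)"

text \<open>Near infinity, \<open>g\<close> is a power series in the parameter with zero constant term.\<close>

definition vanishes_at_infinity ::
  "('a::field fls alg_closure \<Rightarrow> 'c::field) \<Rightarrow> ('c \<Rightarrow> real) \<Rightarrow> ('c \<Rightarrow> 'c) \<Rightarrow> bool" where
  "vanishes_at_infinity emb nrm g \<longleftrightarrow>
     (\<exists>(b :: nat \<Rightarrow> 'c) R. b 0 = 0 \<and>
        (\<forall>z\<in>Omega emb. imag_abs emb nrm z > R \<longrightarrow>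
           (\<lambda>N. nrm (g z - (\<Sum>n\<le>N. b n * u_tA emb nrm z ^ n))) \<longlonglongrightarrow> 0))"

text \<open>
  The space of cusp forms of weight \<open>k\<close> for \<open>\<Gamma>_1(t)\<close>. Elements of \<open>\<Gamma>_1(t)\<close> have determinant \<open>1\<close>,
  so that no type enters. \<open>GL_2(A)\<close> permutes the cusps transitively, and the conjugate of
  \<open>\<Gamma>_1(t)\<close> by any \<open>\<gamma>\<close> in \<open>GL_2(A)\<close> contains the translations by \<open>tA\<close>; for the vanishing
  of \<open>f\<close> at the cusp \<open>\<gamma>(\<infinity>)\<close> it does not matter that the stabilizer may be larger. Functions
  on \<open>Omega\<close> are extended by \<open>0\<close> to the whole type.
\<close>

definition cusp_forms ::
  "('a::{finite,field} fls alg_closure \<Rightarrow> 'c::field) \<Rightarrow> ('c \<Rightarrow> real) \<Rightarrow> nat \<Rightarrow> ('c \<Rightarrow> 'c) set" where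
  "cusp_forms emb nrm k = {f.
     (\<forall>z. z \<notin> Omega emb \<longrightarrow> f z = 0) \<and>
     rigid_analytic emb nrm f \<and>
     (\<forall>\<gamma>\<in>Gamma1_t. \<forall>z\<in>Omega emb. f (moebius emb \<gamma> z) = aut_factor emb \<gamma> z ^ k * f z) \<and>
     (\<forall>\<gamma>\<in>GL2_A. vanishes_at_infinity emb nrm
        (\<lambda>z. inverse (aut_factor emb \<gamma> z) ^ k * f (moebius emb \<gamma> z)))}"

text \<open>The Atkin operator with normalizing scalar \<open>\<kappa>\<close>.\<close>

definition atkin_U ::
  "('a::{finite,field} fls alg_closure \<Rightarrow> 'c::field) \<Rightarrow> 'c \<Rightarrow> ('c \<Rightarrow> 'c) \<Rightarrow> 'c \<Rightarrow> 'c" where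
  "atkin_U emb \<kappa> f z =
     (if z \<in> Omega emb then \<kappa> * (\<Sum>\<beta>\<in>UNIV. f ((z + const_F emb \<beta>) / t_C emb)) else 0)"

subsection \<open>Linear algebra in the space of functions\<close>

definition scale_fun :: "'c::field \<Rightarrow> ('c \<Rightarrow> 'c) \<Rightarrow> 'c \<Rightarrow> 'c" where
  "scale_fun a f = (\<lambda>z. a * f z)"

interpretation fun_space: vector_space "scale_fun :: 'c::field \<Rightarrow> _"
  by unfold_locales (auto simp: scale_fun_def fun_eq_iff algebra_simps)

text \<open>The columns are the coordinates of the images of the basis vectors.\<close>

definition matrix_in_basis ::
  "(('c::field \<Rightarrow> 'c) \<Rightarrow> ('c \<Rightarrow> 'c)) \<Rightarrow> ('c \<Rightarrow> 'c) list \<Rightarrow> 'c mat" where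
  "matrix_in_basis T bs = mat (length bs) (length bs)
     (\<lambda>(i, j). fun_space.representation (set bs) (T (bs ! j)) (bs ! i))"

definition diagonalizable :: "'c::field mat \<Rightarrow> bool" where
  "diagonalizable M \<longleftrightarrow> (\<exists>D. diagonal_mat D \<and> similar_mat M D)"

subsection \<open>The basis coming from harmonic cocycles\<close>

definition binom_int :: "int \<Rightarrow> int \<Rightarrow> nat" where
  "binom_int n m = (if 0 \<le> m \<and> m \<le> n then nat n choose nat m else 0)"

text \<open>The right-hand side of the formula for the image of \<open>c j\<close> under the Atkin operator; the
  range of \<open>h\<close> implements the convention \<open>c i = 0\<close> for \<open>i\<close> outside \<open>{0..k-2}\<close>.\<close>

definition U_formula :: "'c::field \<Rightarrow> nat \<Rightarrow> nat \<Rightarrow> (nat \<Rightarrow> 'c \<Rightarrow> 'c) \<Rightarrow> nat \<Rightarrow> 'c \<Rightarrow> 'c" where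
  "U_formula t q k c j =
     scale_fun (- ((- t) ^ (j + 1)) * of_nat (binom_int (int k - 2 - int j) (int j))) (c j)
     - scale_fun (t ^ (j + 1))
        (\<Sum>h | h \<noteq> 0 \<and> 0 \<le> int j + h * (int q - 1) \<and> int j + h * (int q - 1) \<le> int k - 2.
           scale_fun
             (of_nat (binom_int (int k - 2 - int j - h * (int q - 1)) (- h * (int q - 1)))
              + (- 1) ^ (j + 1)
                * of_nat (binom_int (int k - 2 - int j - h * (int q - 1)) (int j)))
             (c (nat (int j + h * (int q - 1)))))"

definition teitelbaum_basis ::
  "('a::{finite,field} fls alg_closure \<Rightarrow> 'c::field) \<Rightarrow> ('c \<Rightarrow> real) \<Rightarrow> 'c \<Rightarrow> nat
    \<Rightarrow> (nat \<Rightarrow> 'c \<Rightarrow> 'c) \<Rightarrow> bool" where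
  "teitelbaum_basis emb nrm \<kappa> k c \<longleftrightarrow>
     inj_on c {0..k-2} \<and>
     fun_space.independent (c ` {0..k-2}) \<and>
     fun_space.span (c ` {0..k-2}) = cusp_forms emb nrm k \<and>
     (\<forall>j\<in>{0..k-2}. atkin_U emb \<kappa> (c j) = U_formula (t_C emb) CARD('a) k c j)"

definition class_C :: "nat \<Rightarrow> nat \<Rightarrow> (nat \<Rightarrow> 'v) \<Rightarrow> nat \<Rightarrow> 'v list" where
  "class_C q k c j = map c (filter (\<lambda>l. [l = j] (mod (q - 1))) [0..<k - 1])"

end

theory Submission
  imports Defs "HOL-Number_Theory.Residues" "Jordan_Normal_Form.Determinant"
begin

text \<open>
  Put \<open>s = q - 1\<close> and \<open>m = k - 2 - j\<close>. The class has two elements iff \<open>s \<le> m < 2 s\<close>, and then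
  \<open>M_j\<close> has rows \<open>(a, e)\<close> and \<open>(b, 0)\<close>, where \<open>a\<close>, \<open>b\<close> are \<open>\<plusminus>t^(j+1)\<close> times
  \<open>A = binom(m, j)\<close>, \<open>B = binom(m - s, j)\<close>, and \<open>e = - t^(j+s+1) E\<close> with \<open>E\<close> in \<open>F_p\<close>.
  The discriminant is \<open>t^(2j+2) (A^2 \<plusminus> 4 B E t^s)\<close>. It is a square since it comes from the
  algebraic closure, and as \<open>t\<close> is transcendental it can vanish only if \<open>A = 0\<close>. In that case
  \<open>m \<ge> q\<close>, and Lucas' congruence for \<open>m = q + u\<close> gives \<open>A = binom(u, j) = 0\<close>, whence \<open>B\<close> and
  \<open>\<plusminus>E\<close> both equal \<open>binom(u, j - 1)\<close>: either the discriminant is nonzero or \<open>M_j = 0\<close>.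
\<close>

section \<open>Binomial coefficients in characteristic p\<close>

lemma prime_dvd_prime_power_choose:
  fixes p :: nat
  assumes "prime p" and "0 < i" and "i < p ^ r"
  shows "p dvd (p ^ r choose i)"
proof (rule ccontr)
  assume "\<not> p dvd (p ^ r choose i)"
  then have "coprime (p ^ r) (p ^ r choose i)"
    using assms(1) by (simp add: prime_imp_coprime)
  \<comment> \<open>Absorption: i * binom(p^r, i) = p^r * binom(p^r - 1, i - 1).\<close>
  moreover have "p ^ r dvd i * (p ^ r choose i)"
    using times_binomial_minus1_eq[OF assms(2), of "p ^ r"] by simp
  ultimately have "p ^ r dvd i"
    using coprime_dvd_mult_left_iff by blast
  then show False
    using assms(2,3) by (auto dest: dvd_imp_le)
qed

text \<open>In Vandermonde's convolution for p^r + u, only the summands l = 0 and l = p^r survive in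
  characteristic p.\<close>

lemma of_nat_choose_add_prime_power:
  assumes p: "prime p" and char: "of_nat p = (0 :: 'c::comm_ring_1)" and i: "0 < p ^ r"
  shows "of_nat ((p ^ r + u) choose i) =
    (of_nat (u choose i) + (if p ^ r \<le> i then of_nat (u choose (i - p ^ r)) else 0) :: 'c)"
proof -
  let ?q = "p ^ r"
  let ?f = "\<lambda>l. of_nat ((?q choose l) * (u choose (i - l))) :: 'c"
  have z: "?f l = 0" if "l \<noteq> 0" "l \<noteq> ?q" for l
  proof (cases "l < ?q")
    case True
    then have "p dvd ?q choose l"
      using prime_dvd_prime_power_choose[OF p, of l r] that by simp
    then obtain d where "?q choose l = p * d" by (elim dvdE)
    then show ?thesis by (simp add: char)
  next
    case False
    then show ?thesis using that by (simp add: binomial_eq_0)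
  qed
  have "(of_nat ((?q + u) choose i) :: 'c) = (\<Sum>l\<le>i. ?f l)"
    by (simp only: vandermonde[symmetric] of_nat_sum)
  also have "\<dots> = (\<Sum>l\<in>{0, ?q} \<inter> {..i}. ?f l)"
    by (rule sum.mono_neutral_right) (use z in auto)
  also have "\<dots> = of_nat (u choose i) + (if ?q \<le> i then of_nat (u choose (i - ?q)) else 0)"
  proof (cases "?q \<le> i")
    case True
    then have "{0, ?q} \<inter> {..i} = {0, ?q}" by auto
    then show ?thesis using True i by simp
  next
    case False
    then have "{0, ?q} \<inter> {..i} = {0}" by auto
    then show ?thesis using False by simp
  qed
  finally show ?thesis .
qed

text \<open>Row p^r of Pascal's triangle vanishes strictly between its ends, so neighbouring entries
  of row p^r - 1 are negatives of each other; the first entry is 1.\<close>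

lemma of_nat_prime_power_minus_1_choose:
  assumes p: "prime p" and char: "of_nat p = (0 :: 'c::comm_ring_1)"
  shows "i < p ^ r \<Longrightarrow> of_nat ((p ^ r - 1) choose i) = ((- 1) ^ i :: 'c)"
proof (induction i)
  case (Suc i)
  have "(p ^ r choose Suc i) = ((p ^ r - 1) choose i) + ((p ^ r - 1) choose Suc i)"
    using choose_reduce_nat[of "p ^ r" "Suc i"] Suc.prems
    by (metis diff_Suc_1 gr_implies_not_zero neq0_conv zero_less_Suc)
  moreover obtain d where "p ^ r choose Suc i = p * d"
    using prime_dvd_prime_power_choose[OF p, of "Suc i" r] Suc.prems by blast
  ultimately have "of_nat ((p ^ r - 1) choose i) + of_nat ((p ^ r - 1) choose Suc i) = (0 :: 'c)"
    by (metis char mult_zero_left of_nat_add of_nat_mult)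
  then show ?case
    using Suc by (simp add: eq_neg_iff_add_eq_0 add.commute)
qed simp

section \<open>Diagonalizing 2 x 2 matrices\<close>

lemma diagonalizable_2_if_eigenvectors:
  fixes M :: "'c::field mat"
  assumes M: "M \<in> carrier_mat 2 2"
    and "M $$ (0,0) * x1 + M $$ (0,1) * y1 = l1 * x1" "M $$ (1,0) * x1 + M $$ (1,1) * y1 = l1 * y1"
    and "M $$ (0,0) * x2 + M $$ (0,1) * y2 = l2 * x2" "M $$ (1,0) * x2 + M $$ (1,1) * y2 = l2 * y2"
    and det: "x1 * y2 - x2 * y1 \<noteq> 0"
  shows "diagonalizable M"
proof -
  \<comment> \<open>The eigenvectors are the columns of \<open>P\<close>; \<open>Q\<close> is the
    adjugate of \<open>P\<close> times the reciprocal determinant \<open>i\<close>.\<close>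
  define i where "i = inverse (x1 * y2 - x2 * y1)"
  define P where "P = mat 2 2 (\<lambda>(i, l). if i = 0 then (if l = 0 then x1 else x2)
    else (if l = 0 then y1 else y2))"
  define Q where "Q = mat 2 2 (\<lambda>(n, l). if n = 0 then (if l = 0 then y2 * i else - (x2 * i))
    else (if l = 0 then - (y1 * i) else x1 * i))"
  define D where "D = mat 2 2 (\<lambda>(i, l). if i = l then (if l = 0 then l1 else l2) else 0)"
  have dims: "P \<in> carrier_mat 2 2" "Q \<in> carrier_mat 2 2" "D \<in> carrier_mat 2 2"
    by (auto simp: P_def Q_def D_def)
  have "x1 * (y2 * i) - x2 * (y1 * i) = 1" "x1 * (x2 * i) = x2 * (x1 * i)"
    "y1 * (y2 * i) = y2 * (y1 * i)" "y2 * (x1 * i) - y1 * (x2 * i) = 1"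
    using right_inverse[OF det] by (simp_all add: i_def[symmetric] algebra_simps)
  then have PQ: "P * Q = 1\<^sub>m 2"
    by (intro eq_matI) (auto simp: P_def Q_def scalar_prod_def less_Suc_eq numeral_2_eq_2)
  then have QP: "Q * P = 1\<^sub>m 2"
    using mat_mult_left_right_inverse[OF dims(1,2)] by simp
  have "M * P = P * D"
    using assms by (intro eq_matI)
      (auto simp: P_def D_def scalar_prod_def less_Suc_eq numeral_2_eq_2 mult.commute)
  then have "M = P * D * Q"
    by (metis M PQ assoc_mult_mat dims(1,2) right_mult_one_mat)
  moreover have "diagonal_mat D" by (simp add: diagonal_mat_def D_def)
  ultimately show ?thesis
    unfolding diagonalizable_def using M PQ QP dims by (blast intro: similar_matI)
qed

text \<open>Since \<open>w\<close> is a nonzero square root of the discriminant of the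
  characteristic polynomial and 2 is invertible, there are two distinct eigenvalues.\<close>

lemma diagonalizable_2_if_discriminant:
  fixes M :: "'c::field mat"
  assumes M: "M \<in> carrier_mat 2 2" and two: "(2 :: 'c) \<noteq> 0" and w: "w \<noteq> 0"
    and disc: "w ^ 2 = (M $$ (0,0) - M $$ (1,1)) ^ 2 + 4 * M $$ (0,1) * M $$ (1,0)"
  shows "diagonalizable M"
proof (cases "M $$ (1,0) = 0")
  case True
  then have "M $$ (0,0) - M $$ (1,1) \<noteq> 0"
    using disc w by auto
  then show ?thesis
    using True by (intro diagonalizable_2_if_eigenvectors[OF M, of 1 0 "M $$ (0,0)"
      "- M $$ (0,1)" "M $$ (0,0) - M $$ (1,1)" "M $$ (1,1)"]) (auto simp: algebra_simps)
next
  case False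
  define a e b f where abef: "a = M $$ (0,0)" "e = M $$ (0,1)" "b = M $$ (1,0)" "f = M $$ (1,1)"
  \<comment> \<open>Half the trace and half the root of the discriminant: the eigenvalues are g + h
    and g - h.\<close>
  define g h where "g = (a + f) / 2" and "h = w / 2"
  then have gh: "2 * g = a + f" "2 * h = w"
    using two nonzero_mult_div_cancel_left[of 2] by (simp_all only: times_divide_eq_right)
  have four: "(4 :: 'c) \<noteq> 0"
    using two by (metis mult_2 mult_eq_0_iff numeral_Bit0 numeral_plus_numeral one_add_one)
  have g: "a = 2 * g - f" and h: "w = 2 * h"
    by (simp_all add: gh)
  have "4 * (h * h) = 4 * ((g - f) * (g - f) + e * b)"
    using disc unfolding abef[symmetric] g h by (simp add: power2_eq_square algebra_simps)
  then have hh: "h * h = (g - f) * (g - f) + e * b"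
    using four by (metis mult_cancel_left)
  show ?thesis
  \<comment> \<open>An eigenvalue l has the eigenvector (l - f, b): the second row holds
    identically, and the first is the characteristic equation, which is \<open>hh\<close> for both
    eigenvalues.\<close>
  proof (rule diagonalizable_2_if_eigenvectors[OF M, of "g + h - f" b "g + h"
      "g - h - f" b "g - h"]; (unfold abef[symmetric])?)
    have "(g + h - f) * b - (g - h - f) * b = w * b"
      by (simp add: h algebra_simps)
    then show "(g + h - f) * b - (g - h - f) * b \<noteq> 0"
      using False w by (simp add: abef)
  qed (use hh in \<open>simp_all add: g algebra_simps\<close>)
qed

section \<open>The Atkin operator on a class with two elements\<close>

lemma binom_int_of_nat: "binom_int (int a) (int b) = a choose b"
  by (auto simp: binom_int_def binomial_eq_0)

text \<open>This gives the first column of M_j. The bounds on j and m leave only h = 1, whose first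
  binomial has the negative lower entry -s and so is 0 by convention.\<close>

lemma U_formula_lower:
  assumes k: "k = m + j + 2" and q: "q = s + 1" and "j < s" "s \<le> m" "m < 2 * s"
  shows "U_formula t q k c j =
    scale_fun ((- 1) ^ j * t ^ (j + 1) * of_nat (m choose j)) (c j) +
    scale_fun ((- 1) ^ j * t ^ (j + 1) * of_nat ((m - s) choose j)) (c (j + s))"
proof -
  have js: "int j < int s" "int m < 2 * int s" using assms by simp_all
  have "h = 1" if "h \<noteq> 0" "0 \<le> int j + h * int s" "int j + h * int s \<le> int m + int j" for h
  proof -
    have "- 1 * int s < h * int s" "h * int s < 2 * int s"
      using that js by linarith+
    then have "- 1 < h" "h < 2"
      using mult_right_less_imp_less[of "- 1" "int s" h] mult_right_less_imp_less[of h "int s" 2]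
      by auto
    then show ?thesis using that by auto
  qed
  then have H: "{h. h \<noteq> 0 \<and> 0 \<le> int j + h * (int q - 1) \<and> int j + h * (int q - 1) \<le> int k - 2} = {1}"
    using assms by auto
  have "int k - 2 - int j = int m" "int k - 2 - int j - 1 * (int q - 1) = int (m - s)"
    "nat (int j + 1 * (int q - 1)) = j + s" "binom_int (int (m - s)) (- 1 * (int q - 1)) = 0"
    using assms by (auto simp: binom_int_def)
  then show ?thesis
    unfolding U_formula_def H
    by (simp only: binom_int_of_nat sum.insert sum.empty finite.emptyI empty_iff not_False_eq_True)
      (simp add: scale_fun_def fun_eq_iff algebra_simps power_minus[of t])
qed

text \<open>This gives the second column. Only h = -1 stays in range, and the diagonal entry
  vanishes because m - s < s \<le> j + s.\<close>

lemma U_formula_upper: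
  assumes k: "k = m + j + 2" and q: "q = s + 1" and "j < s" "s \<le> m" "m < 2 * s"
  shows "U_formula t q k c (j + s) =
    scale_fun (- (t ^ (j + s + 1)) *
      (of_nat (m choose s) + (- 1) ^ (j + s + 1) * of_nat (m choose (j + s)))) (c j)"
proof -
  have js: "int j < int s" "int m < 2 * int s" using assms by simp_all
  have "h = - 1" if "h \<noteq> 0" "0 \<le> int j + int s + h * int s"
    "int j + int s + h * int s \<le> int m + int j" for h
  proof -
    have "- 2 * int s < h * int s" "h * int s < 1 * int s"
      using that js by linarith+
    then have "- 2 < h" "h < 1"
      using mult_right_less_imp_less[of "- 2" "int s" h] mult_right_less_imp_less[of h "int s" 1]
      by auto
    then show ?thesis using that by auto
  qed
  then have H: "{h. h \<noteq> 0 \<and> 0 \<le> int (j + s) + h * (int q - 1) \<and>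
      int (j + s) + h * (int q - 1) \<le> int k - 2} = {- 1}"
    using assms by auto
  have "int k - 2 - int (j + s) = int (m - s)" "int (m - s) - (- 1) * (int q - 1) = int m"
    "nat (int (j + s) + (- 1) * (int q - 1)) = j" "- (- 1) * (int q - 1) = int s"
    "(m - s) choose (j + s) = 0"
    using assms by (auto intro: binomial_eq_0)
  then show ?thesis
    unfolding U_formula_def H
    by (simp only: binom_int_of_nat sum.insert sum.empty finite.emptyI empty_iff not_False_eq_True)
      (simp add: scale_fun_def fun_eq_iff algebra_simps)
qed

text \<open>The indices of the class are j, j + s, j + 2 s, ... up to k - 2, so the second must be
  in range and the third out of it. Sortedness of the list fixes the order of the basis.\<close>

lemma class_C_two_elements:
  assumes inj: "inj_on c {0..k - 2}" and q: "q = s + 1" and "j < s" and "2 \<le> k"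
    and card: "card (set (class_C q k c j)) = 2"
  shows "j + s \<le> k - 2" "k - 2 < j + 2 * s" "class_C q k c j = [c j, c (j + s)]"
proof -
  define L where "L = filter (\<lambda>l. [l = j] (mod (q - 1))) [0..<k - 1]"
  have mem: "l \<in> set L \<longleftrightarrow> l \<le> k - 2 \<and> l mod s = j" for l
    using assms by (auto simp: L_def cong_def)
  then have "inj_on c (set L)"
    using inj by (auto intro: inj_on_subset)
  then have card_L: "card (set L) = 2"
    using card by (simp add: class_C_def L_def[symmetric] card_image del: set_filter One_nat_def)
  show le: "j + s \<le> k - 2"
  proof (rule ccontr)
    assume less: "\<not> j + s \<le> k - 2"
    have "set L \<subseteq> {j}"
    proof
      fix l assume "l \<in> set L"
      then have l: "l = l div s * s + j" "l < j + s"
        using mem less div_mult_mod_eq[of l s] by auto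
      then have "l div s * s < 1 * s" by linarith
      then have "l div s = 0" by simp
      then show "l \<in> {j}" using l(1) by simp
    qed
    then have "card (set L) \<le> 1" using card_mono[of "{j}"] by fastforce
    then show False using card_L by simp
  qed
  show lt: "k - 2 < j + 2 * s"
  proof (rule ccontr)
    assume "\<not> k - 2 < j + 2 * s"
    then have "{j, j + s, j + 2 * s} \<subseteq> set L" using mem assms by auto
    then have "card {j, j + s, j + 2 * s} \<le> 2"
      using card_mono card_L by (metis List.finite_set)
    then show False using assms by auto
  qed
  have "{j, j + s} \<subseteq> set L" using mem le assms by auto
  moreover have "card {j, j + s} = 2" using assms by simp
  ultimately have "set L = {j, j + s}"
    using card_L by (metis List.finite_set card_subset_eq)
  moreover have "sorted L" "distinct L" by (simp_all add: L_def sorted_wrt_filter)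
  ultimately have "L = [j, j + s]"
    by (intro sorted_distinct_set_unique) (use assms in auto)
  then show "class_C q k c j = [c j, c (j + s)]"
    by (simp add: class_C_def L_def)
qed

lemma representation_two_basis:
  fixes u v :: "'c::field \<Rightarrow> 'c"
  assumes "fun_space.independent B" "u \<in> B" "v \<in> B"
  shows "fun_space.representation B (scale_fun x u + scale_fun y v) =
    (\<lambda>b. (if b = u then x else 0) + (if b = v then y else 0))"
  using assms
  by (auto simp: fun_space.representation_add fun_space.representation_scale
      fun_space.representation_basis fun_space.span_scale fun_space.span_base)

section \<open>Descending to the algebraic closure and to Laurent series\<close>

context C_infinity
begin

lemma emb_0: "emb 0 = 0"
  using emb_add[of 0 0] by (metis add.right_neutral add_left_cancel)

lemma emb_of_nat: "emb (of_nat n) = of_nat n"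
  by (induction n) (auto simp: emb_0 emb_1 emb_add)

lemma emb_numeral: "emb (numeral n) = numeral n"
  using emb_of_nat[of "numeral n"] by simp

lemma emb_power: "emb (x ^ n) = emb x ^ n"
  by (induction n) (auto simp: emb_1 emb_mult)

lemma emb_diff: "emb (x - y) = emb x - emb y"
  using emb_add[of "x - y" y] by simp

lemma emb_of_int: "emb (of_int x) = of_int x"
  by (cases x rule: int_diff_cases) (simp add: emb_of_nat emb_diff)

lemma emb_eq_0_iff: "emb x = 0 \<longleftrightarrow> x = 0"
proof
  assume "emb x = 0"
  then have "emb (x * inverse x) = 0" by (simp add: emb_mult)
  then show "x = 0" using emb_1 by (cases "x = 0") auto
qed (simp add: emb_0)

lemma of_nat_C_eq_0_iff: "(of_nat n :: 'c) = 0 \<longleftrightarrow> (of_nat n :: 'a) = 0"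
  by (metis emb_eq_0_iff emb_of_nat of_nat_eq_0_iff_char_dvd semiring_char_fls
      to_ac_eq_0_iff to_ac_of_nat)

text \<open>With integer parameters the radicand is an image under \<open>emb\<close>, so the root
  can be taken in the algebraic closure.\<close>

lemma sqrt_in_C:
  fixes A :: nat and x :: int
  obtains w where "w ^ 2 = of_nat A ^ 2 + 4 * of_int x * t_C emb ^ s"
proof -
  obtain y :: "'a fls alg_closure" where "y ^ 2 = of_nat A ^ 2 + 4 * of_int x * to_ac fls_X_inv ^ s"
    using nth_root_exists[of 2] by auto
  then have "emb y ^ 2 = of_nat A ^ 2 + 4 * of_int x * t_C emb ^ s"
    by (metis emb_power emb_add emb_mult emb_of_nat emb_of_int emb_numeral t_C_def)
  then show ?thesis by (rule that)
qed

text \<open>Transcendence of t takes the form of comparing coefficients: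
  \<open>fls_X_inv ^ s\<close> is supported at index -s, so the coefficient of the series at index 0
  is A^2.\<close>

lemma discriminant_nonzero:
  fixes A :: nat and x :: int
  assumes "s > 0" "(of_nat A :: 'c) \<noteq> 0"
  shows "of_nat A ^ 2 + 4 * of_int x * t_C emb ^ s \<noteq> 0"
proof
  let ?D = "of_nat (A ^ 2) + of_int (4 * x) * fls_X_inv ^ s :: 'a fls"
  assume "of_nat A ^ 2 + 4 * of_int x * t_C emb ^ s = 0"
  then have "emb (to_ac ?D) = 0"
    by (simp add: emb_power emb_add emb_mult emb_of_nat emb_of_int emb_numeral t_C_def)
  then have "fls_nth ?D 0 = 0" unfolding emb_eq_0_iff to_ac_eq_0_iff by simp
  then have "(of_nat (A ^ 2) :: 'a) = 0"
    using assms(1) by (simp add: fls_of_nat fls_of_int)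
  then show False
    using assms(2) of_nat_C_eq_0_iff by simp
qed

end

theorem theorem4p3:
  fixes emb :: "'a::{finite,field} fls alg_closure \<Rightarrow> 'c::field"
    and nrm :: "'c \<Rightarrow> real"
    and \<kappa> :: 'c
    and c :: "nat \<Rightarrow> 'c \<Rightarrow> 'c"
    and p r q k j :: nat
  assumes "prime p" and "odd p" and "q = p ^ r" and "CARD('a) = q"
    and "C_infinity emb nrm"
    and "k > q + 3"
    and "\<kappa> \<noteq> 0"
    and "teitelbaum_basis emb nrm \<kappa> k c"
    and "j \<le> q - 2"
    and "card (set (class_C q k c j)) = 2"
  shows "diagonalizable (matrix_in_basis (atkin_U emb \<kappa>) (class_C q k c j))"
proof -
  interpret C_infinity emb nrm by fact
  note prime = \<open>prime p\<close>
  define t where "t = t_C emb"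
  have "prime CHAR('a)"
    by (intro prime_CHAR_semidom finite_imp_CHAR_pos) simp
  moreover have "CHAR('a) dvd p ^ r"
    using CHAR_dvd_CARD[where 'a = 'a] assms(3,4) by simp
  ultimately have char_a: "CHAR('a) = p"
    using prime by (metis prime_dvd_power primes_dvd_imp_eq)
  then have of_nat_0: "(of_nat n :: 'c) = 0 \<longleftrightarrow> p dvd n" for n
    by (simp add: of_nat_C_eq_0_iff of_nat_eq_0_iff_char_dvd)
  then have char: "of_nat p = (0 :: 'c)" by simp
  have "\<not> p dvd 2"
    using \<open>odd p\<close> prime by (metis even_iff_mod_2_eq_zero primes_dvd_imp_eq two_is_prime_nat)
  then have two: "(2 :: 'c) \<noteq> 0"
    using of_nat_0[of 2] by simp
  have "card {0, 1 :: 'a} \<le> CARD('a)" by (rule card_mono) auto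
  then have q2: "2 \<le> q" using assms(4) by simp
  define s where "s = q - 1"
  have q: "q = s + 1" "p ^ r = s + 1" and js: "j < s"
    using q2 assms(3,9) by (auto simp: s_def)
  \<comment> \<open>Evenness of s turns the sign (-1)^(j+s+1) in the second column into the
    (-1)^(j+1) of \<open>E0\<close>.\<close>
  have "odd q" using assms(2,3) by simp
  then have "even s" using q by simp
  have k: "2 \<le> k" using assms(6) by simp
  have inj: "inj_on c {0..k - 2}" and ind: "fun_space.independent (c ` {0..k - 2})"
    and U: "\<And>l. l \<le> k - 2 \<Longrightarrow> atkin_U emb \<kappa> (c l) = U_formula t q k c l"
    using assms(4,8) by (auto simp: teitelbaum_basis_def t_def)
  note cls = class_C_two_elements[OF inj q(1) js k assms(10)]
  define m where "m = k - 2 - j"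
  have m: "k = m + j + 2" "s \<le> m" "m < 2 * s"
    using cls(1,2) js k by (auto simp: m_def)
  define B where "B = set (class_C q k c j)"
  have B: "B = {c j, c (j + s)}" using cls(3) by (simp add: B_def)
  have ne: "c j \<noteq> c (j + s)"
    using assms(10) by (auto simp: B_def[symmetric] B)
  have indB: "fun_space.independent B"
    by (rule fun_space.independent_mono[OF ind]) (use cls(1) in \<open>auto simp: B\<close>)
  define A0 B0 E0 where AE: "A0 = (of_nat (m choose j) :: 'c)"
    "B0 = (of_nat ((m - s) choose j) :: 'c)"
    "E0 = (of_nat (m choose s) + (- 1) ^ (j + 1) * of_nat (m choose (j + s)) :: 'c)"
  have Uj: "atkin_U emb \<kappa> (c j) =
      scale_fun ((- 1) ^ j * t ^ (j + 1) * A0) (c j) +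
      scale_fun ((- 1) ^ j * t ^ (j + 1) * B0) (c (j + s))"
    using U_formula_lower[OF m(1) q(1) js m(2,3)] U[of j] cls(1) by (simp add: AE)
  define e where "e = - (t ^ (j + s + 1)) * E0"
  have Ujs: "atkin_U emb \<kappa> (c (j + s)) = scale_fun e (c j)"
    using U_formula_upper[OF m(1) q(1) js m(2,3)] U[of "j + s"] cls(1) \<open>even s\<close>
    by (simp add: AE e_def scale_fun_def fun_eq_iff power_add)
  define M where "M = matrix_in_basis (atkin_U emb \<kappa>) (class_C q k c j)"
  have M_carrier: "M \<in> carrier_mat 2 2"
    by (simp add: M_def matrix_in_basis_def cls(3) numeral_2_eq_2)
  have rep: "fun_space.representation {c j, c (j + s)} (scale_fun x (c j) + scale_fun y (c (j + s))) =
      (\<lambda>b. (if b = c j then x else 0) + (if b = c (j + s) then y else 0))" for x y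
    using representation_two_basis[OF indB] unfolding B by simp
  have M: "M $$ (0,0) = (- 1) ^ j * t ^ (j + 1) * A0" "M $$ (1,0) = (- 1) ^ j * t ^ (j + 1) * B0"
    "M $$ (0,1) = e" "M $$ (1,1) = 0"
    using ne by (simp_all add: M_def matrix_in_basis_def cls(3) Uj Ujs rep rep[of e 0, simplified])
  have t0: "t \<noteq> 0" unfolding t_def t_C_def emb_eq_0_iff by simp
  \<comment> \<open>An integer, so that the discriminant can be lifted to \<open>'a fls\<close>.\<close>
  define x where "x = - ((- 1) ^ j * int ((m - s) choose j) *
    (int (m choose s) + (- 1) ^ (j + 1) * int (m choose (j + s))))"
  have x: "of_int x = - ((- 1) ^ j * B0 * E0)"
    by (simp add: x_def AE)
  obtain w where w: "w ^ 2 = A0 ^ 2 + 4 * of_int x * t ^ s"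
    using sqrt_in_C[of "m choose j" x s] unfolding t_def AE by metis
  have "diagonalizable M" if "w \<noteq> 0"
  proof (rule diagonalizable_2_if_discriminant[OF M_carrier two, of "t ^ (j + 1) * w"])
    show "t ^ (j + 1) * w \<noteq> 0" using that t0 by simp
    \<comment> \<open>The off-diagonal product carries t^(j+s+1) t^(j+1) = t^(2j+2) t^s, so t^(2j+2)
      splits off the discriminant.\<close>
    have "((- 1) ^ j) ^ 2 = (1 :: 'c)" by (simp flip: power_mult)
    then show "(t ^ (j + 1) * w) ^ 2 =
        (M $$ (0,0) - M $$ (1,1)) ^ 2 + 4 * M $$ (0,1) * M $$ (1,0)"
      unfolding M e_def power_mult_distrib w x
      by (simp add: power_mult_distrib power_add power2_eq_square algebra_simps)
  qed
  moreover have "w \<noteq> 0 \<or> (A0 = 0 \<and> B0 = 0 \<and> E0 = 0)"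
  proof (cases "A0 = 0")
    case False
    then show ?thesis
      using discriminant_nonzero[of s "m choose j" x] js w unfolding AE t_def
      by (metis gr_zeroI not_less_zero power2_eq_square mult_zero_left)
  next
    case True
    \<comment> \<open>\<open>A0\<close> is 1 for j = 0 and (-1)^j for m = s = p^r - 1, so neither
      case can occur here.\<close>
    have "0 < j" using True by (cases j) (auto simp: AE)
    have "m \<noteq> s"
      using True of_nat_prime_power_minus_1_choose[OF prime char, of j r] js q
      by (auto simp: AE)
    \<comment> \<open>Now m \<ge> q, and u = m - q satisfies u + 1 < s.\<close>
    define u where "u = m - s - 1"
    have u: "m = p ^ r + u" "m - s = Suc u" "Suc u < s"
      using m \<open>m \<noteq> s\<close> q by (auto simp: u_def)
    note lucas = of_nat_choose_add_prime_power[OF prime char, of r u, folded u(1)]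
    \<comment> \<open>As j < q, the second term of the congruence is absent.\<close>
    have "of_nat (u choose j) = (0 :: 'c)"
      using True lucas[of j] q js by (simp add: AE)
    moreover have "Suc u choose j = (u choose (j - 1)) + (u choose j)"
      using choose_reduce_nat[of "Suc u" j] \<open>0 < j\<close> by simp
    ultimately have "B0 = of_nat (u choose (j - 1))"
      by (simp add: AE u(2))
    \<comment> \<open>Both u choose s and u choose (j + s) vanish because u < s. Since j + s = q +
      (j - 1), the shifted term of the congruence remains.\<close>
    moreover have "E0 = (- 1) ^ (j + 1) * of_nat (u choose (j - 1))"
      using lucas[of s] lucas[of "j + s"] q u(3) \<open>0 < j\<close> by (simp add: AE binomial_eq_0)
    ultimately have "B0 \<noteq> 0 \<and> E0 \<noteq> 0 \<or> B0 = 0 \<and> E0 = 0" by simp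
    \<comment> \<open>With \<open>A0\<close> zero, only the term 4 x t^s of the discriminant is
      left, and x is \<open>B0 * E0\<close> up to sign.\<close>
    moreover have "w \<noteq> 0" if "B0 \<noteq> 0" "E0 \<noteq> 0"
    proof -
      have "(2 * 2 :: 'c) \<noteq> 0" using two by (metis mult_eq_0_iff)
      then have "w ^ 2 \<noteq> 0"
        unfolding w x True using that t0 by simp
      then show ?thesis by auto
    qed
    ultimately show ?thesis using True by blast
  qed
  moreover have "diagonalizable M" if "A0 = 0" "B0 = 0" "E0 = 0"
  proof -
    \<comment> \<open>Here all four entries of \<open>M\<close> are zero.\<close>
    have "diagonal_mat M"
      using M that e_def M_carrier by (auto simp: diagonal_mat_def less_Suc_eq numeral_2_eq_2)
    then show ?thesis
      unfolding diagonalizable_def using similar_mat_refl[OF M_carrier] by blast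
  qed
  ultimately show ?thesis unfolding M_def by blast
qed

end
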